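(* Let $A \in \mathbb{R}^{n \times n}$ be a nonzero symmetric and positive semi-definite matrix with rows $A_1,\dots,A_n$. Let $i$ be an index with $$ i = \arg\max_{1 \leq j \leq n,\ A_{jj} \neq 0} \frac{\|A_j\|_{\ell^2}^2}{A_{jj}},$$ that is, $i$ attains the maximum of $\|A_j\|_{\ell^2}^2/A_{jj}$ among all $j\in\{1,\dots,n\}$ with $A_{jj}\neq 0$, and let $$B = A - \frac{A_i^{T} A_i}{A_{ii}}.$$ Then $$\left\| B \right\|_F^2 \leq \left(1- \frac{1}{n} \right) \|A\|_F^2.$$
   Context: $A_i$ denotes the $i$-th row of $A$, viewed as a $1\times n$ row vector, so that $A_i^T A_i$ is an $n \times n$ rank-one matrix with entries $(A_i^TA_i)_{jk} = A_{ij}A_{ik}$. $\|A_j\|_{\ell^2}$ is the Euclidean norm of the $j$-th row and $\|\cdot\|_F$ is the Frobenius norm. Passing from $A$ to $B$ is what is meant by "removing the $i$-th row/column" (one step of partial Cholesky with pivot $i$). *)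

theory Defs
  imports "HOL-Analysis.Analysis"
begin

definition pos_semidef :: "real ^ 'n ^ 'n \<Rightarrow> bool" where
  "pos_semidef A \<longleftrightarrow> (\<forall>x. 0 \<le> x \<bullet> (A *v x))"

definition row_matrix :: "'n \<Rightarrow> real ^ 'n ^ 'n \<Rightarrow> real ^ 'n ^ 1" where
  "row_matrix i A = rowvector (row i A)"

definition cholesky_step :: "'n \<Rightarrow> real ^ 'n ^ 'n \<Rightarrow> real ^ 'n ^ 'n" where
  "cholesky_step i A =
     A - (1 / A $ i $ i) *\<^sub>R (transpose (row_matrix i A) ** row_matrix i A)"

lemma cholesky_step_nth:
  "cholesky_step i A $ j $ k = A $ j $ k - A $ i $ j * A $ i $ k / A $ i $ i"
  by (simp add: cholesky_step_def row_matrix_def rowvector_def row_def transpose_def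
      matrix_matrix_mult_def)

text \<open>The norm that the library puts on matrices of type \<open>real ^ 'n ^ 'm\<close> is the
  Frobenius norm, not an operator norm.\<close>

lemma norm_matrix_eq_frobenius:
  fixes A :: "real ^ 'n ^ 'm"
  shows "norm A = sqrt (\<Sum>i\<in>UNIV. \<Sum>j\<in>UNIV. (A $ i $ j)\<^sup>2)"
  by (simp add: norm_vec_def L2_set_def sum_nonneg)

end

theory Submission
  imports Defs
begin

text \<open>
  Write \<open>a\<close> for the pivot row \<open>A\<^sub>i\<close>, \<open>d = A\<^sub>i\<^sub>i\<close> for the pivot and \<open>m = \<parallel>a\<parallel>\<^sup>2 / d\<close> for the maximal ratio.
  Expanding the square of the Frobenius norm of \<open>A - a\<^sup>T a / d\<close> gives
  \<open>\<parallel>B\<parallel>\<^sup>2 = \<parallel>A\<parallel>\<^sup>2 - 2 (a \<bullet> A a) / d + \<parallel>a\<parallel>\<^sup>4 / d\<^sup>2\<close>.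
  The Cauchy-Schwarz inequality for the semi-inner product \<open>x \<bullet> A y\<close>, applied to \<open>a\<close> and the
  unit vector \<open>e\<^sub>i\<close>, reads \<open>\<parallel>a\<parallel>\<^sup>4 \<le> d (a \<bullet> A a)\<close>, because \<open>a = A e\<^sub>i\<close>. Hence the step lowers the
  squared norm by at least \<open>m\<^sup>2\<close> (lemma \<open>norm_cholesky_step_le\<close>).

  It remains to see that \<open>m\<^sup>2\<close> is at least the average of the \<open>n\<close> numbers \<open>\<parallel>A\<^sub>j\<parallel>\<^sup>2\<close>, which add up to
  \<open>\<parallel>A\<parallel>\<^sup>2\<close>. In fact it is at least each of them: rows with vanishing diagonal entry are zero, and
  otherwise \<open>\<parallel>A\<^sub>j\<parallel>\<^sup>2 \<le> m A\<^sub>j\<^sub>j \<le> m \<parallel>A\<^sub>j\<parallel>\<close> by maximality of \<open>m\<close>, so that \<open>\<parallel>A\<^sub>j\<parallel> \<le> m\<close>.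
\<close>

lemma inner_matrix_vector_symmetric:
  fixes A :: "real ^ 'n ^ 'n"
  assumes "transpose A = A"
  shows "x \<bullet> (A *v y) = y \<bullet> (A *v x)"
  by (metis assms dot_lmul_matrix inner_commute transpose_matrix_vector)

lemma inner_axis_matrix_vector:
  fixes A :: "real ^ 'n ^ 'n"
  shows "axis j 1 \<bullet> (A *v x) = row j A \<bullet> x"
  by (simp add: inner_axis' matrix_vector_mul_component row_def)

lemma row_nth_diag: "row j A \<bullet> axis j 1 = (A :: real ^ 'n ^ 'n) $ j $ j"
  by (simp add: inner_axis row_def)

text \<open>The form \<open>t \<mapsto> (x + t y) \<bullet> A (x + t y)\<close> is a nonnegative quadratic polynomial, so its
  discriminant is not positive. The form may be degenerate, so the coefficient of \<open>t\<^sup>2\<close> can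
  vanish; then the polynomial is affine and nonnegative, hence constant.\<close>

lemma pos_semidef_Cauchy_Schwarz:
  fixes A :: "real ^ 'n ^ 'n"
  assumes sym: "transpose A = A" and psd: "pos_semidef A"
  shows "(x \<bullet> (A *v y))\<^sup>2 \<le> (x \<bullet> (A *v x)) * (y \<bullet> (A *v y))"
proof -
  define p q r where "p = x \<bullet> (A *v x)" and "q = x \<bullet> (A *v y)" and "r = y \<bullet> (A *v y)"
  have quad: "0 \<le> p + 2 * t * q + t\<^sup>2 * r" for t
  proof -
    have "(x + t *\<^sub>R y) \<bullet> (A *v (x + t *\<^sub>R y)) = p + 2 * t * q + t\<^sup>2 * r"
      using inner_matrix_vector_symmetric[OF sym, of y x]
      by (simp add: p_def q_def r_def matrix_vector_right_distrib matrix_vector_mult_scaleR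
          inner_add_left inner_add_right power2_eq_square algebra_simps)
    then show ?thesis
      using psd by (metis pos_semidef_def)
  qed
  have "0 \<le> r"
    using psd by (simp add: pos_semidef_def r_def)
  have "q\<^sup>2 \<le> p * r"
  proof (cases "r = 0")
    case True
    have "q = 0"
    proof (rule ccontr)
      assume "q \<noteq> 0"
      \<comment> \<open>at this \<open>t\<close> the affine polynomial \<open>p + 2 t q\<close> takes the value \<open>- 1\<close>\<close>
      then show False
        using quad[of "- (p + 1) / (2 * q)"] True \<open>q \<noteq> 0\<close> by (simp add: field_simps)
    qed
    with True show ?thesis by simp
  next
    case False
    with \<open>0 \<le> r\<close> have "0 < r" by simp
    \<comment> \<open>the minimum of the polynomial is at \<open>t = - q / r\<close>\<close>
    have "0 \<le> p - q\<^sup>2 / r"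
      using quad[of "- q / r"] \<open>0 < r\<close> by (simp add: field_simps power2_eq_square)
    then show ?thesis
      using \<open>0 < r\<close> by (simp add: field_simps)
  qed
  then show ?thesis
    by (simp add: p_def q_def r_def)
qed

text \<open>This is the Cauchy-Schwarz inequality against a unit vector, whose image under the
  symmetric matrix \<open>A\<close> is a row of \<open>A\<close>.\<close>

lemma pos_semidef_row_Cauchy_Schwarz:
  fixes A :: "real ^ 'n ^ 'n"
  assumes "transpose A = A" and "pos_semidef A"
  shows "(row j A \<bullet> x)\<^sup>2 \<le> A $ j $ j * (x \<bullet> (A *v x))"
  using pos_semidef_Cauchy_Schwarz[OF assms, of "axis j 1" x]
  by (simp add: inner_axis_matrix_vector row_nth_diag)

lemma pos_semidef_diag_nonneg:
  fixes A :: "real ^ 'n ^ 'n"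
  assumes "pos_semidef A"
  shows "0 \<le> A $ j $ j"
  using assms by (metis inner_axis_matrix_vector pos_semidef_def row_nth_diag)

lemma pos_semidef_row_eq_0:
  fixes A :: "real ^ 'n ^ 'n"
  assumes "transpose A = A" and "pos_semidef A" and "A $ j $ j = 0"
  shows "row j A = 0"
  using pos_semidef_row_Cauchy_Schwarz[OF assms(1,2), of j "row j A"] assms(3) by simp

lemma norm_matrix_power2_rows:
  fixes A :: "real ^ 'n ^ 'm"
  shows "(norm A)\<^sup>2 = (\<Sum>j\<in>UNIV. (norm (row j A))\<^sup>2)"
  by (simp add: norm_vec_def L2_set_def sum_nonneg row_def)

lemma norm_cholesky_step_power2:
  fixes A :: "real ^ 'n ^ 'n" and i :: 'n
  defines "a \<equiv> row i A" and "d \<equiv> A $ i $ i"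
  shows "(norm (cholesky_step i A))\<^sup>2
    = (norm A)\<^sup>2 - 2 * (a \<bullet> (A *v a)) / d + ((norm a)\<^sup>2 / d)\<^sup>2"
proof -
  have row_step: "row j (cholesky_step i A) = row j A - (a $ j / d) *\<^sub>R a" for j
    by (simp add: vec_eq_iff row_def cholesky_step_nth a_def d_def)
  have "(norm (row j (cholesky_step i A)))\<^sup>2
      = (norm (row j A))\<^sup>2 - 2 / d * (a $ j * (A *v a) $ j) + (norm a)\<^sup>2 / d\<^sup>2 * (a $ j * a $ j)"
    for j
  proof -
    have "(A *v a) $ j = row j A \<bullet> a"
      by (simp add: matrix_vector_mul_component row_def)
    then show ?thesis
      unfolding row_step power2_norm_eq_inner
      by (simp add: inner_diff_left inner_diff_right inner_commute power2_eq_square algebra_simps)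
  qed
  then have "(norm (cholesky_step i A))\<^sup>2
      = (norm A)\<^sup>2 - 2 / d * (a \<bullet> (A *v a)) + (norm a)\<^sup>2 / d\<^sup>2 * (a \<bullet> a)"
    by (simp add: norm_matrix_power2_rows inner_vec_def[of a] sum.distrib sum_subtractf
        sum_distrib_left)
  then show ?thesis
    by (simp add: power2_norm_eq_inner[symmetric] power_divide power2_eq_square)
qed

lemma norm_cholesky_step_le:
  fixes A :: "real ^ 'n ^ 'n"
  assumes sym: "transpose A = A" and psd: "pos_semidef A" and "A $ i $ i \<noteq> 0"
  shows "(norm (cholesky_step i A))\<^sup>2 \<le> (norm A)\<^sup>2 - ((norm (row i A))\<^sup>2 / A $ i $ i)\<^sup>2"
proof -
  define a d where "a = row i A" and "d = A $ i $ i"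
  have "0 < d"
    using pos_semidef_diag_nonneg[OF psd, of i] assms(3) by (simp add: d_def)
  have "((norm a)\<^sup>2)\<^sup>2 \<le> d * (a \<bullet> (A *v a))"
    using pos_semidef_row_Cauchy_Schwarz[OF sym psd, of i a]
    by (simp add: a_def d_def power2_norm_eq_inner)
  then have "((norm a)\<^sup>2 / d)\<^sup>2 \<le> (a \<bullet> (A *v a)) / d"
    using \<open>0 < d\<close> by (simp add: power2_eq_square field_simps)
  then show ?thesis
    using norm_cholesky_step_power2[of i A] by (simp add: a_def d_def)
qed

text \<open>A diagonal entry is at most the norm of its row, so a bound \<open>m\<close> on the ratios
  \<open>\<parallel>A\<^sub>j\<parallel>\<^sup>2 / A\<^sub>j\<^sub>j\<close> also bounds the row norms.\<close>

lemma pos_semidef_row_norm_le: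
  fixes A :: "real ^ 'n ^ 'n"
  assumes sym: "transpose A = A" and psd: "pos_semidef A" and "0 \<le> m"
    and bound: "A $ j $ j \<noteq> 0 \<Longrightarrow> (norm (row j A))\<^sup>2 / A $ j $ j \<le> m"
  shows "norm (row j A) \<le> m"
proof (cases "A $ j $ j = 0")
  case True
  then show ?thesis
    using pos_semidef_row_eq_0[OF sym psd] \<open>0 \<le> m\<close> by simp
next
  case False
  then have pos: "0 < A $ j $ j"
    using pos_semidef_diag_nonneg[OF psd, of j] by simp
  have diag_le: "A $ j $ j \<le> norm (row j A)"
    using component_le_norm_cart[of "row j A" j] pos by (simp add: row_def)
  have "norm (row j A) * norm (row j A) \<le> m * A $ j $ j"
    using bound[OF False] pos by (simp add: field_simps power2_eq_square)
  also have "\<dots> \<le> m * norm (row j A)"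
    using diag_le \<open>0 \<le> m\<close> by (rule mult_left_mono)
  finally show ?thesis
    using pos diag_le \<open>0 \<le> m\<close> by (cases "row j A = 0") simp_all
qed

theorem corollary2:
  fixes A B :: "real ^ 'n ^ 'n" and i :: 'n
  assumes "A \<noteq> 0"
    and "transpose A = A"
    and "pos_semidef A"
    and "is_arg_max (\<lambda>j. (norm (row j A))\<^sup>2 / A $ j $ j) (\<lambda>j. A $ j $ j \<noteq> 0) i"
    and "B = cholesky_step i A"
  shows "(norm B)\<^sup>2 \<le> (1 - 1 / real CARD('n)) * (norm A)\<^sup>2"
proof -
  define m where "m = (norm (row i A))\<^sup>2 / A $ i $ i"
  have pivot: "A $ i $ i \<noteq> 0"
    and max: "\<And>j. A $ j $ j \<noteq> 0 \<Longrightarrow> (norm (row j A))\<^sup>2 / A $ j $ j \<le> m"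
    using assms(4) by (auto simp: is_arg_max_def m_def not_less)
  have "0 \<le> m"
    using pos_semidef_diag_nonneg[OF assms(3), of i] by (simp add: m_def)
  have "(norm A)\<^sup>2 \<le> (\<Sum>j\<in>(UNIV :: 'n set). m\<^sup>2)"
    unfolding norm_matrix_power2_rows
    using pos_semidef_row_norm_le[OF assms(2,3) \<open>0 \<le> m\<close> max]
    by (intro sum_mono power_mono) auto
  then have "(norm A)\<^sup>2 / real CARD('n) \<le> m\<^sup>2"
    by (simp add: field_simps)
  moreover have "(norm B)\<^sup>2 \<le> (norm A)\<^sup>2 - m\<^sup>2"
    using norm_cholesky_step_le[OF assms(2,3) pivot] by (simp add: assms(5) m_def)
  ultimately show ?thesis
    by (simp add: algebra_simps)
qed

end
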